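(* For every $n\ge 0$ and every $0\le r\le n$, there is an explicit invertible map $$\Phi_n:B_n(r)\longrightarrow C_n(r).$$
   Context: All matrices are over the field $\mathbb F_2$ with two elements. $B_n(r)$ is the set of $n\times n$ upper triangular matrices $X$ over $\mathbb F_2$ with $X^2=0$ and $\operatorname{rank}X=r$. $C_n(r)$ is the set of $n\times n$ upper triangular matrices $U$ over $\mathbb F_2$ with $U^TU=0$ and $\operatorname{rank}U=r$. For $n=0$, both $B_0(0)$ and $C_0(0)$ consist of the empty matrix. *)

theory Defs
  imports "HOL-Library.Z2" "Jordan_Normal_Form.DL_Rank"
begin

text \<open>The field with two elements is the type \<^typ>\<open>bit\<close> of \<^theory>\<open>HOL-Library.Z2\<close>.\<close>

definition square_zero_mats :: "nat \<Rightarrow> nat \<Rightarrow> bit mat set" where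
  "square_zero_mats n r =
     {X \<in> carrier_mat n n. upper_triangular X \<and> X * X = 0\<^sub>m n n \<and> vec_space.rank n X = r}"

definition self_orthogonal_mats :: "nat \<Rightarrow> nat \<Rightarrow> bit mat set" where
  "self_orthogonal_mats n r =
     {U \<in> carrier_mat n n. upper_triangular U \<and> transpose_mat U * U = 0\<^sub>m n n
        \<and> vec_space.rank n U = r}"

text \<open>
  The explicit map is built column by column. A matrix \<open>X\<close> of size \<open>n + 1\<close> that is upper
  triangular with \<open>X\<^sup>2 = 0\<close> is a matrix \<open>Y\<close> of size \<open>n\<close> of the same kind, bordered by a last
  column \<open>(v, 0)\<close> with \<open>Y v = 0\<close>; its rank is that of \<open>Y\<close> if \<open>v\<close> is in the image of \<open>Y\<close>,
  and one more otherwise. A matrix \<open>U\<close> of size \<open>n + 1\<close> that is upper triangular with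
  \<open>U\<^sup>T U = 0\<close> is a matrix \<open>V\<close> of size \<open>n\<close> of the same kind, bordered by a last column
  \<open>(w, w \<bullet> w)\<close> with \<open>V\<^sup>T w = 0\<close> (the corner entry \<open>a\<close> has to satisfy \<open>w \<bullet> w + a\<^sup>2 = 0\<close>,
  that is \<open>a = w \<bullet> w\<close>); its rank is that of \<open>V\<close> if \<open>w\<close> is in the image of \<open>V\<close>, and one
  more otherwise. If \<open>V\<close> is the matrix assigned to \<open>Y\<close>, the vectors \<open>v\<close> and \<open>w\<close> are matched
  by their position in lexicographic order: image with image, and remaining kernel vectors
  with remaining kernel vectors.
\<close>

primrec lex_vecs :: "nat \<Rightarrow> bit vec list" where
  "lex_vecs 0 = [vNil]"
| "lex_vecs (Suc n) = map (vCons 0) (lex_vecs n) @ map (vCons 1) (lex_vecs n)"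

definition image_list :: "nat \<Rightarrow> bit mat \<Rightarrow> bit vec list" where
  "image_list n A = filter (\<lambda>v. v \<in> set (map (\<lambda>x. A *\<^sub>v x) (lex_vecs n))) (lex_vecs n)"

text \<open>
  In \<open>admissible_cols n K A\<close>, the columns in the kernel of \<open>K\<close> are listed, those in the image of
  \<open>A\<close> first. It is used with \<open>K = A\<close> for \<open>A\<^sup>2 = 0\<close>, and with \<open>K = A\<^sup>T\<close> for
  \<open>A\<^sup>T A = 0\<close>; in both cases the image of \<open>A\<close> is contained in the kernel of \<open>K\<close>.
\<close>

definition admissible_cols :: "nat \<Rightarrow> bit mat \<Rightarrow> bit mat \<Rightarrow> bit vec list" where
  "admissible_cols n K A =
     image_list n A
     @ filter (\<lambda>v. K *\<^sub>v v = 0\<^sub>v n \<and> v \<notin> set (image_list n A)) (lex_vecs n)"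

definition match_col :: "nat \<Rightarrow> bit mat \<Rightarrow> bit mat \<Rightarrow> bit vec \<Rightarrow> bit vec" where
  "match_col n Y V v =
     the (map_of (zip (admissible_cols n Y Y) (admissible_cols n (transpose_mat V) V)) v)"

definition leading_block :: "nat \<Rightarrow> 'a mat \<Rightarrow> 'a mat" where
  "leading_block n X = mat n n (\<lambda>ij. X $$ ij)"

definition border :: "nat \<Rightarrow> bit mat \<Rightarrow> bit vec \<Rightarrow> bit \<Rightarrow> bit mat" where
  "border n V w a = mat (Suc n) (Suc n)
     (\<lambda>(i, j). if j < n then (if i < n then V $$ (i, j) else 0)
               else (if i < n then w $ i else a))"

primrec Phi :: "nat \<Rightarrow> bit mat \<Rightarrow> bit mat" where
  "Phi 0 X = X"
| "Phi (Suc n) X =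
     (let Y = leading_block n X;
          V = Phi n Y;
          w = match_col n Y V (vec n (\<lambda>i. X $$ (i, n)))
      in border n V w (w \<bullet> w))"

end

theory Submission
  imports Defs "Jordan_Normal_Form.Matrix_Kernel"
begin

text \<open>
  Deleting the last row and column turns a square-zero upper triangular matrix of size \<open>n + 1\<close>
  into a pair of a square-zero upper triangular matrix \<open>Y\<close> of size \<open>n\<close> and a vector
  \<open>v \<in> ker Y\<close>; the corner is forced to be \<open>0\<close>. In the same way, an upper triangular \<open>U\<close> with
  \<open>U\<^sup>T U = 0\<close> becomes a pair of such a \<open>V\<close> of size \<open>n\<close> and a vector \<open>w \<in> ker V\<^sup>T\<close>; the corner
  is forced to be \<open>w \<bullet> w\<close>. Both correspondences are bijections
  (\<open>bij_betw_border_square_zero\<close>, \<open>bij_betw_border_self_orthogonal\<close>). So the recursion for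
  \<open>Phi\<close> yields a bijection as soon as, for \<open>V = Phi n Y\<close>, the columns are matched
  bijectively (\<open>match_col\<close>).

  The list matching is bijective when the lists have equal lengths, that is, when
  \<open>|im Y| = |im V|\<close> and \<open>|ker Y| = |ker V\<^sup>T|\<close>. The second equation follows from the first:
  \<open>|ker A| |im A| = 2\<^sup>n\<close> for every \<open>A\<close> of size \<open>n\<close> (\<open>card_kernel_times_card_image\<close>), and
  \<open>|ker A\<^sup>T| = |ker A|\<close>, which is proved by counting the pairs with \<open>x \<bullet> (A y) = 0\<close> in two
  ways (\<open>card_kernel_transpose\<close>).

  It remains to carry \<open>|im Y| = |im V|\<close> through the induction. Adding a column \<open>v\<close> doubles the
  image if \<open>v\<close> lies outside of it and does not change its size otherwise
  (\<open>card_image_border\<close>), and the matching sends image vectors to image vectors and other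
  vectors to other vectors. Since \<open>|im A| = 2\<^sup>r\<close> for a matrix of rank \<open>r\<close>
  (\<open>card_mat_image\<close>), the size of the image is a substitute for the rank that can be computed
  by elementary counting. \<open>Phi\<close> is therefore shown to be a bijection for all ranks at once that
  preserves the size of the image, and the statement for a given rank is its restriction.
\<close>

(* These rules would turn sums and products of bits into bit operations, out of reach of the ring laws. *)
declare add_bit_eq_xor [simp del] mult_bit_eq_and [simp del]

section \<open>Counting the image and the kernel of a matrix\<close>

text \<open>
  This is the column space, in a form that needs no dimension parameter.
\<close>

definition mat_image :: "'a :: semiring_0 mat \<Rightarrow> 'a vec set" where
  "mat_image A = (\<lambda>x. A *\<^sub>v x) ` carrier_vec (dim_col A)"

text \<open>
  A maximal independent set of columns spans the column space, so the matrix with these columns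
  has the same image, is injective, and has \<open>rank A\<close> columns.
\<close>

lemma (in vec_space) card_mat_image:
  assumes A: "A \<in> carrier_mat n nc"
  shows "card (mat_image A) = card (carrier_vec (rank A) :: 'a vec set)"
proof -
  have cols: "set (cols A) \<subseteq> carrier_vec n"
    using A cols_dim by blast
  have "\<exists>S. finite S \<and> maximal S (\<lambda>T. T \<subseteq> set (cols A) \<and> lin_indpt T) \<and> {} \<subseteq> S"
    by (rule maximal_exists_superset[of "set (cols A)"]) (auto simp: finite_lin_indpt2)
  then obtain S where S: "maximal S (\<lambda>T. T \<subseteq> set (cols A) \<and> lin_indpt T)"
    by blast
  have S_cols: "S \<subseteq> set (cols A)" and S_ind: "lin_indpt S"
    using S by (auto simp: maximal_def)
  have S_carrier: "S \<subseteq> carrier_vec n"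
    using S_cols cols by blast
  \<comment> \<open>By maximality, no column can be added to \<open>S\<close> without losing independence.\<close>
  have "s \<in> span S" if s: "s \<in> set (cols A)" for s
  proof (rule ccontr)
    assume out: "s \<notin> span S"
    have "s \<notin> S"
      using out in_own_span[OF S_carrier] by blast
    have "lin_indpt (insert s S)"
      using lin_dep_iff_in_span[of S s] S_carrier S_ind \<open>s \<notin> S\<close> out s cols by auto
    then show False
      using S s S_cols \<open>s \<notin> S\<close> by (auto simp: maximal_def)
  qed
  then have span_eq: "span S = span (set (cols A))"
    using span_subsetI[OF S_carrier, of "set (cols A)"] span_is_monotone[OF S_cols] by blast
  obtain ss where ss: "set ss = S" "distinct ss"
    using finite_distinct_list[of S] S_cols finite_subset by blast
  define B where "B = mat_of_cols n ss"
  have B: "B \<in> carrier_mat n (length ss)" and cols_B: "cols B = ss"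
    using ss S_carrier by (auto simp: B_def)
  have rank: "rank A = length ss"
    using rank_card_indpt[OF A S] ss distinct_card by force
  have image: "mat_image M = span (set (cols M))" if "M \<in> carrier_mat n m" for M :: "'a mat" and m
    using col_space_eq[OF that] that by (auto simp: col_space_def mat_image_def)
  have "inj_on (\<lambda>x. B *\<^sub>v x) (carrier_vec (length ss))"
  proof (rule inj_onI)
    fix x y :: "'a vec"
    assume xy: "x \<in> carrier_vec (length ss)" "y \<in> carrier_vec (length ss)" "B *\<^sub>v x = B *\<^sub>v y"
    then have "B *\<^sub>v (x - y) = 0\<^sub>v n"
      using B by (simp add: mult_minus_distrib_mat_vec[OF B])
    then have "x - y = 0\<^sub>v (length ss)"
      using lin_depI[OF B, of "x - y"] S_ind cols_B ss xy by auto
    then show "x = y"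
      using xy by (auto simp: vec_eq_iff)
  qed
  then have "card (mat_image B) = card (carrier_vec (length ss) :: 'a vec set)"
    using B by (simp add: mat_image_def card_image)
  then show ?thesis
    using image[OF A] image[OF B] span_eq cols_B ss rank by simp
qed

text \<open>
  All fibres of \<open>x \<mapsto> A x\<close> over the image are translates of the kernel. Choosing a preimage \<open>s y\<close>
  for each \<open>y\<close> in the image makes \<open>(z, y) \<mapsto> z + s y\<close> a bijection.
\<close>

lemma card_kernel_times_card_image:
  fixes A :: "'a :: comm_ring_1 mat"
  assumes A: "A \<in> carrier_mat nr nc"
  shows "card (mat_kernel A) * card (mat_image A) = card (carrier_vec nc :: 'a vec set)"
proof -
  have "\<forall>y\<in>mat_image A. \<exists>x. x \<in> carrier_vec nc \<and> A *\<^sub>v x = y"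
    using A by (auto simp: mat_image_def)
  then obtain s where s: "\<And>y. y \<in> mat_image A \<Longrightarrow> s y \<in> carrier_vec nc \<and> A *\<^sub>v s y = y"
    by metis
  have im: "A *\<^sub>v x \<in> mat_image A" if "x \<in> carrier_vec nc" for x
    using A that by (auto simp: mat_image_def)
  have im_carrier: "y \<in> carrier_vec nr" if "y \<in> mat_image A" for y
    using A that by (auto simp: mat_image_def)
  have "bij_betw (\<lambda>(z, y). z + s y) (mat_kernel A \<times> mat_image A) (carrier_vec nc)"
  proof (rule bij_betw_byWitness[where f' = "\<lambda>x. (x - s (A *\<^sub>v x), A *\<^sub>v x)"])
    have *: "A *\<^sub>v (z + s y) = y" "z + s y - s y = z"
      if "z \<in> mat_kernel A" "y \<in> mat_image A" for z y
      using mat_kernelD[OF A that(1)] s[OF that(2)] im_carrier[OF that(2)]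
      by (auto simp: mult_add_distrib_mat_vec[OF A] vec_eq_iff)
    then show "\<forall>p\<in>mat_kernel A \<times> mat_image A.
        (\<lambda>x. (x - s (A *\<^sub>v x), A *\<^sub>v x)) ((\<lambda>(z, y). z + s y) p) = p"
      by auto
    show "\<forall>x\<in>carrier_vec nc :: 'a vec set. (\<lambda>(z, y). z + s y) (x - s (A *\<^sub>v x), A *\<^sub>v x) = x"
    proof
      fix x :: "'a vec" assume "x \<in> carrier_vec nc"
      then show "(\<lambda>(z, y). z + s y) (x - s (A *\<^sub>v x), A *\<^sub>v x) = x"
        using s[OF im[of x]] by (auto simp: vec_eq_iff)
    qed
    show "(\<lambda>(z, y). z + s y) ` (mat_kernel A \<times> mat_image A) \<subseteq> carrier_vec nc"
      using mat_kernelD(1)[OF A] s by auto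
    have "x - s (A *\<^sub>v x) \<in> mat_kernel A" if "x \<in> carrier_vec nc" for x
      using that A s[OF im[OF that]]
      by (intro mat_kernelI[OF A]) (auto simp: mult_minus_distrib_mat_vec[OF A])
    then show "(\<lambda>x. (x - s (A *\<^sub>v x), A *\<^sub>v x)) ` carrier_vec nc \<subseteq> mat_kernel A \<times> mat_image A"
      using im by auto
  qed
  then show ?thesis
    using bij_betw_same_card card_cartesian_product by metis
qed

lemma mat_image_subset_mat_kernel:
  fixes A K :: "'a :: comm_ring_1 mat"
  assumes "A \<in> carrier_mat n m" "K \<in> carrier_mat l n" "K * A = 0\<^sub>m l m"
  shows "mat_image A \<subseteq> mat_kernel K"
  using assms by (auto simp: mat_image_def mat_kernel assoc_mult_mat_vec[symmetric])

section \<open>Vectors over the field with two elements\<close>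

lemma bit_add_self: "b + b = (0 :: bit)"
  by (cases b) simp_all

lemma set_lex_vecs: "set (lex_vecs n) = carrier_vec n"
proof (induction n)
  case 0
  show ?case by auto
next
  case (Suc n)
  have "v \<in> vCons 0 ` carrier_vec n \<union> vCons 1 ` carrier_vec n"
    if "v \<in> carrier_vec (Suc n)" for v :: "bit vec"
    using that by (cases v) (auto simp: image_iff intro: bit.exhaust)
  with Suc show ?case by auto
qed

lemma distinct_lex_vecs: "distinct (lex_vecs n)"
  by (induction n) (auto simp: distinct_map inj_on_def)

lemma length_lex_vecs: "length (lex_vecs n) = 2 ^ n"
  by (induction n) auto

lemma finite_bit_vecs [simp]: "finite (carrier_vec n :: bit vec set)"
  by (metis List.finite_set set_lex_vecs)

lemma card_bit_vecs: "card (carrier_vec n :: bit vec set) = 2 ^ n"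
  by (metis set_lex_vecs distinct_lex_vecs length_lex_vecs distinct_card)

text \<open>
  If \<open>w\<close> has an entry \<open>1\<close> at position \<open>i\<close>, flipping the \<open>i\<close>-th entry of \<open>x\<close> flips \<open>x \<bullet> w\<close>, so exactly half
  of all vectors are orthogonal to \<open>w\<close>.
\<close>

lemma two_times_card_orthogonal:
  fixes w :: "bit vec"
  assumes w: "w \<in> carrier_vec n"
  shows "2 * card {x \<in> carrier_vec n. x \<bullet> w = 0} = (1 + of_bool (w = 0\<^sub>v n)) * 2 ^ n"
proof (cases "w = 0\<^sub>v n")
  case True
  then have "{x \<in> carrier_vec n. x \<bullet> w = 0} = carrier_vec n"
    by auto
  then show ?thesis
    using True card_bit_vecs[of n] by simp
next
  case False
  let ?O = "{x \<in> carrier_vec n. x \<bullet> w = 0}" and ?N = "{x \<in> carrier_vec n. x \<bullet> w = 1}"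
  obtain i where i: "i < n" "w $ i = 1"
    using w False by (auto simp: vec_eq_iff)
  let ?e = "unit_vec n i :: bit vec"
  have shift: "(x + ?e) \<bullet> w = x \<bullet> w + 1" "x + ?e + ?e = x" if "x \<in> carrier_vec n" for x
    using that w i by (auto simp: add_scalar_prod_distrib[of _ n] vec_eq_iff add.assoc bit_add_self)
  have "bij_betw (\<lambda>x. x + ?e) ?O ?N"
    by (rule bij_betw_byWitness[where f' = "\<lambda>x. x + ?e"]) (use shift in auto)
  then have "card ?O = card ?N"
    by (rule bij_betw_same_card)
  moreover have "carrier_vec n = ?O \<union> ?N" "?O \<inter> ?N = {}"
    by auto
  then have "card ?O + card ?N = 2 ^ n"
    by (metis (no_types, lifting) card_Un_disjoint card_bit_vecs finite_Un finite_bit_vecs)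
  ultimately show ?thesis
    using False by simp
qed

text \<open>
  The pairs \<open>(x, y)\<close> with \<open>x \<bullet> (A y) = 0\<close> number \<open>2\<^sup>n\<close> for each \<open>y\<close> in the kernel of \<open>A\<close> and
  \<open>2\<^sup>n\<^sup>-\<^sup>1\<close> for any other \<open>y\<close>, so their number determines the size of the kernel. It is the same
  number for \<open>A\<^sup>T\<close>, because \<open>x \<bullet> (A y) = y \<bullet> (A\<^sup>T x)\<close>.
\<close>

lemma card_kernel_transpose:
  fixes A :: "bit mat"
  assumes A: "A \<in> carrier_mat n n"
  shows "card (mat_kernel (transpose_mat A)) = card (mat_kernel A)"
proof -
  let ?C = "carrier_vec n :: bit vec set"
  let ?P = "\<lambda>M. SIGMA y:?C. {x \<in> ?C. x \<bullet> (M *\<^sub>v y) = 0}"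
  have count: "2 * card (?P M) = 2 ^ n * (2 ^ n + card (mat_kernel M))"
    if M: "M \<in> carrier_mat n n" for M
  proof -
    have "2 * card (?P M) = (\<Sum>y\<in>?C. 2 * card {x \<in> ?C. x \<bullet> (M *\<^sub>v y) = 0})"
      by (simp add: card_SigmaI sum_distrib_left)
    also have "\<dots> = (\<Sum>y\<in>?C. (1 + of_bool (M *\<^sub>v y = 0\<^sub>v n)) * 2 ^ n)"
      using M by (intro sum.cong refl two_times_card_orthogonal) auto
    also have "\<dots> = 2 ^ n * (card ?C + card {y \<in> ?C. M *\<^sub>v y = 0\<^sub>v n})"
      by (simp add: sum_distrib_right[symmetric] sum.distrib Int_def algebra_simps)
    finally show ?thesis
      using M by (simp add: mat_kernel card_bit_vecs)
  qed
  have "y \<bullet> (transpose_mat A *\<^sub>v x) = x \<bullet> (A *\<^sub>v y)" if "x \<in> ?C" "y \<in> ?C" for x y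
    using that A transpose_vec_mult_scalar[OF A that(2,1)]
    by (metis comm_scalar_prod mult_mat_vec_carrier transpose_carrier_mat)
  then have "bij_betw prod.swap (?P A) (?P (transpose_mat A))"
    by (intro bij_betw_byWitness[where f' = prod.swap]) auto
  then have "card (?P A) = card (?P (transpose_mat A))"
    by (rule bij_betw_same_card)
  then show ?thesis
    using count[OF A] count[of "transpose_mat A"] A by simp
qed

section \<open>Matching the admissible columns\<close>

text \<open>
  Two lists of the same length are matched position by position; as the cut between first and
  second part is at the same position in both, first parts correspond to first parts.
\<close>

lemma map_of_zip_matching:
  assumes xs: "distinct (xs1 @ xs2)" and ys: "distinct (ys1 @ ys2)"
    and len: "length xs1 = length ys1" "length xs2 = length ys2"
  defines "f \<equiv> \<lambda>x. the (map_of (zip (xs1 @ xs2) (ys1 @ ys2)) x)"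
  shows "bij_betw f (set (xs1 @ xs2)) (set (ys1 @ ys2))"
    and "x \<in> set (xs1 @ xs2) \<Longrightarrow> f x \<in> set ys1 \<longleftrightarrow> x \<in> set xs1"
proof -
  have nth: "f ((xs1 @ xs2) ! i) = (ys1 @ ys2) ! i" if "i < length (xs1 @ xs2)" for i
    using that xs len by (simp add: f_def map_of_zip_nth del: append_assoc zip_append)
  then have map: "map f (xs1 @ xs2) = ys1 @ ys2"
    using len nth by (intro nth_equalityI) (simp_all del: map_append)
  then have map1: "map f xs1 = ys1" and map2: "map f xs2 = ys2"
    using len by auto
  show "bij_betw f (set (xs1 @ xs2)) (set (ys1 @ ys2))"
    using ys unfolding map[symmetric] bij_betw_def distinct_map by (metis set_map)
  show "f x \<in> set ys1 \<longleftrightarrow> x \<in> set xs1" if "x \<in> set (xs1 @ xs2)"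
    using that ys unfolding map1[symmetric] map2[symmetric] by auto
qed

lemma set_image_list:
  assumes "A \<in> carrier_mat n n"
  shows "set (image_list n A) = mat_image A"
  using assms by (auto simp: image_list_def set_lex_vecs mat_image_def)

text \<open>
  The listings of \<open>ker Y\<close> and \<open>ker V\<^sup>T\<close>, images first, have both parts of equal length: the
  images by hypothesis, and the kernels because the size of the image determines that of the
  kernel, which transposition does not change.
\<close>

lemma match_col:
  assumes Y: "Y \<in> carrier_mat n n" "mat_image Y \<subseteq> mat_kernel Y"
    and V: "V \<in> carrier_mat n n" "mat_image V \<subseteq> mat_kernel (transpose_mat V)"
    and card_eq: "card (mat_image Y) = card (mat_image V)"
  shows bij_betw_match_col: "bij_betw (match_col n Y V) (mat_kernel Y) (mat_kernel (transpose_mat V))"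
    and match_col_in_image: "v \<in> mat_kernel Y \<Longrightarrow> match_col n Y V v \<in> mat_image V \<longleftrightarrow> v \<in> mat_image Y"
proof -
  define rest where "rest K A = filter (\<lambda>v. K *\<^sub>v v = 0\<^sub>v n \<and> v \<notin> set (image_list n A)) (lex_vecs n)"
    for K A :: "bit mat"
  have adm: "admissible_cols n K A = image_list n A @ rest K A" for K A
    by (simp add: admissible_cols_def rest_def)
  have dist: "distinct (image_list n A @ rest K A)" for K A
    by (auto simp: rest_def image_list_def distinct_lex_vecs)
  have set: "set (image_list n A @ rest K A) = mat_kernel K"
    if "A \<in> carrier_mat n n" "K \<in> carrier_mat n n" "mat_image A \<subseteq> mat_kernel K" for K A
    using that by (auto simp: rest_def set_image_list set_lex_vecs mat_kernel)
  have len_image: "length (image_list n A) = card (mat_image A)" if "A \<in> carrier_mat n n" for A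
    using dist[of A] set_image_list[OF that] distinct_card by fastforce
  have len: "length (image_list n A @ rest K A) = card (mat_kernel K)"
    if "A \<in> carrier_mat n n" "K \<in> carrier_mat n n" "mat_image A \<subseteq> mat_kernel K" for K A
    using distinct_card[OF dist] set[OF that] by metis
  have VT: "transpose_mat V \<in> carrier_mat n n"
    using V by simp
  have "card (mat_image Y) > 0"
    using Y(1) by (simp add: mat_image_def card_gt_0_iff)
      (metis empty_iff zero_carrier_vec)
  moreover have "card (mat_kernel Y) * card (mat_image Y) = card (mat_kernel V) * card (mat_image V)"
    using Y(1) V(1) by (simp add: card_kernel_times_card_image)
  ultimately have "card (mat_kernel Y) = card (mat_kernel (transpose_mat V))"
    using card_eq card_kernel_transpose[OF V(1)] by simp
  then have len1: "length (image_list n Y) = length (image_list n V)"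
    and len2: "length (rest Y Y) = length (rest (transpose_mat V) V)"
    using len_image[OF Y(1)] len_image[OF V(1)] len[OF Y(1) Y] len[OF V(1) VT V(2)] card_eq
    by auto
  have f: "match_col n Y V = (\<lambda>x. the (map_of (zip (image_list n Y @ rest Y Y)
      (image_list n V @ rest (transpose_mat V) V)) x))"
    by (simp add: fun_eq_iff match_col_def adm)
  note matching = map_of_zip_matching[OF dist dist len1 len2, folded f]
  show "bij_betw (match_col n Y V) (mat_kernel Y) (mat_kernel (transpose_mat V))"
    using matching(1) set[OF Y(1) Y] set[OF V(1) VT V(2)] by simp
  show "match_col n Y V v \<in> mat_image V \<longleftrightarrow> v \<in> mat_image Y" if "v \<in> mat_kernel Y"
    using matching(2)[of v] that set[OF Y(1) Y] set_image_list[OF Y(1)] set_image_list[OF V(1)]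
    unfolding f by (simp only:)
qed

section \<open>Bordered matrices\<close>

lemma border_carrier [simp]: "border n V w a \<in> carrier_mat (Suc n) (Suc n)"
  by (simp add: border_def)

lemma index_border:
  "i < Suc n \<Longrightarrow> j < Suc n \<Longrightarrow> border n V w a $$ (i, j) =
     (if j < n then (if i < n then V $$ (i, j) else 0) else (if i < n then w $ i else a))"
  by (simp add: border_def)

lemma leading_block_border [simp]:
  "V \<in> carrier_mat n n \<Longrightarrow> leading_block n (border n V w a) = V"
  by (rule eq_matI) (auto simp: leading_block_def index_border)

lemma last_col_border [simp]:
  "w \<in> carrier_vec n \<Longrightarrow> vec n (\<lambda>i. border n V w a $$ (i, n)) = w"
  by (rule eq_vecI) (auto simp: index_border)

lemma border_eq_iff:
  assumes "V \<in> carrier_mat n n" "V' \<in> carrier_mat n n" "w \<in> carrier_vec n" "w' \<in> carrier_vec n"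
  shows "border n V w a = border n V' w' a' \<longleftrightarrow> V = V' \<and> w = w' \<and> a = a'"
proof
  assume eq: "border n V w a = border n V' w' a'"
  have "border n V w a $$ (n, n) = border n V' w' a' $$ (n, n)"
    by (simp only: eq)
  then have "a = a'"
    by (simp add: index_border)
  with eq assms show "V = V' \<and> w = w' \<and> a = a'"
    by (metis leading_block_border last_col_border)
qed simp

lemma zero_mat_eq_border: "0\<^sub>m (Suc n) (Suc n) = border n (0\<^sub>m n n) (0\<^sub>v n) 0"
  by (rule eq_matI) (auto simp: border_def)

lemma border_leading_block:
  assumes "X \<in> carrier_mat (Suc n) (Suc n)" "upper_triangular X"
  shows "border n (leading_block n X) (vec n (\<lambda>i. X $$ (i, n))) (X $$ (n, n)) = X"
  using assms by (intro eq_matI) (auto simp: border_def leading_block_def less_Suc_eq)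

lemma upper_triangular_border:
  assumes "V \<in> carrier_mat n n"
  shows "upper_triangular (border n V w a) \<longleftrightarrow> upper_triangular V"
  using assms by (auto simp: upper_triangular_def border_def less_Suc_eq)

lemma border_mult_border:
  assumes "V \<in> carrier_mat n n" "V' \<in> carrier_mat n n" "w \<in> carrier_vec n" "w' \<in> carrier_vec n"
  shows "border n V w a * border n V' w' a' = border n (V * V') (V *\<^sub>v w' + a' \<cdot>\<^sub>v w) (a * a')"
proof (rule eq_matI)
  fix i j
  assume "i < dim_row (border n (V * V') (V *\<^sub>v w' + a' \<cdot>\<^sub>v w) (a * a'))"
    and "j < dim_col (border n (V * V') (V *\<^sub>v w' + a' \<cdot>\<^sub>v w) (a * a'))"
  then have ij: "i < Suc n" "j < Suc n"
    by (auto simp: border_def)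
  have "(border n V w a * border n V' w' a') $$ (i, j)
      = (\<Sum>k<Suc n. border n V w a $$ (i, k) * border n V' w' a' $$ (k, j))"
    using ij by (simp add: border_def scalar_prod_def lessThan_atLeast0)
  also have "\<dots> = (\<Sum>k<n. border n V w a $$ (i, k) * border n V' w' a' $$ (k, j))
      + border n V w a $$ (i, n) * border n V' w' a' $$ (n, j)"
    by simp
  also have "\<dots> = border n (V * V') (V *\<^sub>v w' + a' \<cdot>\<^sub>v w) (a * a') $$ (i, j)"
    using ij assms by (auto simp: index_border scalar_prod_def lessThan_atLeast0 mult.commute)
  finally show "(border n V w a * border n V' w' a') $$ (i, j)
      = border n (V * V') (V *\<^sub>v w' + a' \<cdot>\<^sub>v w) (a * a') $$ (i, j)" .
qed (auto simp: border_def)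

lemma zero_smult_vec: "v \<in> carrier_vec n \<Longrightarrow> (0 :: 'a :: semiring_0) \<cdot>\<^sub>v v = 0\<^sub>v n"
  by (auto simp: vec_eq_iff)

text \<open>
  The corner of the square is \<open>a\<^sup>2\<close>, so \<open>a = 0\<close>, and then the last column of the square is \<open>Y v\<close>.
\<close>

lemma border_square_zero_iff:
  assumes "Y \<in> carrier_mat n n" "v \<in> carrier_vec n"
  shows "border n Y v a * border n Y v a = 0\<^sub>m (Suc n) (Suc n)
    \<longleftrightarrow> Y * Y = 0\<^sub>m n n \<and> v \<in> mat_kernel Y \<and> a = 0"
proof -
  have "border n Y v a * border n Y v a = 0\<^sub>m (Suc n) (Suc n)
    \<longleftrightarrow> Y * Y = 0\<^sub>m n n \<and> Y *\<^sub>v v + a \<cdot>\<^sub>v v = 0\<^sub>v n \<and> a * a = 0"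
    using assms by (simp add: border_mult_border zero_mat_eq_border border_eq_iff)
  also have "\<dots> \<longleftrightarrow> Y * Y = 0\<^sub>m n n \<and> v \<in> mat_kernel Y \<and> a = 0"
    using assms by (cases a) (simp_all add: mat_kernel[OF assms(1)] zero_smult_vec)
  finally show ?thesis .
qed

text \<open>
  The entries of \<open>U\<^sup>T U\<close> are the inner products of the columns of \<open>U\<close>, which are the columns of
  \<open>V\<close> extended by \<open>0\<close>, and \<open>(w, a)\<close>. The norm of the last one is \<open>w \<bullet> w + a\<^sup>2 = w \<bullet> w + a\<close>.
\<close>

lemma border_self_orthogonal_iff:
  assumes V: "V \<in> carrier_mat n n" and w: "w \<in> carrier_vec n"
  shows "transpose_mat (border n V w a) * border n V w a = 0\<^sub>m (Suc n) (Suc n)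
    \<longleftrightarrow> transpose_mat V * V = 0\<^sub>m n n \<and> w \<in> mat_kernel (transpose_mat V) \<and> a = w \<bullet> w"
proof -
  let ?U = "border n V w a"
  let ?G = "transpose_mat ?U * ?U"
  have G: "?G $$ (i, j) = (\<Sum>k<n. ?U $$ (k, i) * ?U $$ (k, j)) + ?U $$ (n, i) * ?U $$ (n, j)"
    if "i < Suc n" "j < Suc n" for i j
  proof -
    have "?G $$ (i, j) = (\<Sum>k<Suc n. ?U $$ (k, i) * ?U $$ (k, j))"
      using that by (simp add: border_def scalar_prod_def lessThan_atLeast0)
    then show ?thesis by simp
  qed
  have G_block: "?G $$ (i, j) = (transpose_mat V * V) $$ (i, j)" if "i < n" "j < n" for i j
    using that V by (simp add: G index_border scalar_prod_def lessThan_atLeast0)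
  have G_col: "?G $$ (i, n) = (transpose_mat V *\<^sub>v w) $ i" if "i < n" for i
    using that V w by (simp add: G index_border scalar_prod_def lessThan_atLeast0)
  have G_row: "?G $$ (n, i) = (transpose_mat V *\<^sub>v w) $ i" if "i < n" for i
    using that V w by (simp add: G index_border scalar_prod_def lessThan_atLeast0 mult.commute)
  have G_corner: "?G $$ (n, n) = w \<bullet> w + a"
  proof -
    have "a * a = a"
      by (cases a) simp_all
    then show ?thesis
      using w by (simp add: G index_border scalar_prod_def lessThan_atLeast0)
  qed
  have "?G = 0\<^sub>m (Suc n) (Suc n) \<longleftrightarrow> (\<forall>i<Suc n. \<forall>j<Suc n. ?G $$ (i, j) = 0)"
    by (auto simp: mat_eq_iff border_def)
  also have "\<dots> \<longleftrightarrow> (\<forall>i<n. \<forall>j<n. (transpose_mat V * V) $$ (i, j) = 0)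
      \<and> (\<forall>i<n. (transpose_mat V *\<^sub>v w) $ i = 0) \<and> w \<bullet> w + a = 0"
    unfolding less_Suc_eq using G_block G_col G_row G_corner by auto
  also have "\<dots> \<longleftrightarrow> transpose_mat V * V = 0\<^sub>m n n \<and> w \<in> mat_kernel (transpose_mat V) \<and> w \<bullet> w + a = 0"
    using V w by (auto simp: mat_eq_iff vec_eq_iff mat_kernel_def)
  also have "w \<bullet> w + a = 0 \<longleftrightarrow> a = w \<bullet> w"
    by (cases a; cases "w \<bullet> w") simp_all
  finally show ?thesis .
qed

definition vec_snoc :: "nat \<Rightarrow> 'a vec \<Rightarrow> 'a \<Rightarrow> 'a vec" where
  "vec_snoc n x c = vec (Suc n) (\<lambda>i. if i < n then x $ i else c)"

lemma vec_snoc_eq_iff: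
  assumes "x \<in> carrier_vec n" "y \<in> carrier_vec n"
  shows "vec_snoc n x c = vec_snoc n y d \<longleftrightarrow> x = y \<and> c = d"
  using assms by (auto simp: vec_snoc_def vec_eq_iff All_less_Suc)

lemma carrier_vec_Suc_eq_vec_snoc:
  "carrier_vec (Suc n) = (\<Union>c. (\<lambda>x. vec_snoc n x c) ` carrier_vec n)"
proof -
  have "v = vec_snoc n (vec n (\<lambda>i. v $ i)) (v $ n)" if "v \<in> carrier_vec (Suc n)" for v :: "'a vec"
    using that by (auto simp: vec_snoc_def less_Suc_eq)
  then show ?thesis
    by (fastforce simp: vec_snoc_def)
qed

lemma border_mult_vec_snoc:
  assumes "V \<in> carrier_mat n n" "w \<in> carrier_vec n" "x \<in> carrier_vec n"
  shows "border n V w a *\<^sub>v vec_snoc n x c = vec_snoc n (V *\<^sub>v x + c \<cdot>\<^sub>v w) (a * c)"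
proof (rule eq_vecI)
  fix i assume "i < dim_vec (vec_snoc n (V *\<^sub>v x + c \<cdot>\<^sub>v w) (a * c))"
  then have i: "i < Suc n"
    by (simp add: vec_snoc_def)
  have "(border n V w a *\<^sub>v vec_snoc n x c) $ i
      = (\<Sum>k<Suc n. border n V w a $$ (i, k) * vec_snoc n x c $ k)"
    using i by (simp add: border_def vec_snoc_def scalar_prod_def lessThan_atLeast0)
  also have "\<dots> = vec_snoc n (V *\<^sub>v x + c \<cdot>\<^sub>v w) (a * c) $ i"
    using i assms
    by (auto simp: vec_snoc_def index_border scalar_prod_def lessThan_atLeast0 mult.commute)
  finally show "(border n V w a *\<^sub>v vec_snoc n x c) $ i
      = vec_snoc n (V *\<^sub>v x + c \<cdot>\<^sub>v w) (a * c) $ i" .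
qed (simp add: border_def vec_snoc_def)

text \<open>
  With \<open>T = im V\<close>, the image of the bordered matrix is the union of \<open>T \<times> {0}\<close> and its translate
  by \<open>(w, a)\<close>. They coincide if \<open>w \<in> T\<close>, where \<open>a = 0\<close> by assumption, and are disjoint otherwise.
\<close>

lemma card_image_border:
  assumes V: "V \<in> carrier_mat n n" and w: "w \<in> carrier_vec n"
    and corner: "w \<in> mat_image V \<Longrightarrow> a = 0"
  shows "card (mat_image (border n V w a)) = (if w \<in> mat_image V then 1 else 2) * card (mat_image V)"
proof -
  let ?T = "mat_image V" and ?f = "\<lambda>z. vec_snoc n z 0" and ?g = "\<lambda>z. vec_snoc n (z + w) a"
  have T_carrier: "z \<in> carrier_vec n" if "z \<in> ?T" for z
    using that V by (auto simp: mat_image_def)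
  have T_add: "z + z' \<in> ?T" if "z \<in> ?T" "z' \<in> ?T" for z z'
    using that V
    by (auto simp: mat_image_def image_iff mult_add_distrib_mat_vec[symmetric] intro: add_carrier_vec)
  have T_finite: "finite ?T"
    by (simp add: mat_image_def)
  have cancel: "z + w + w = z" if "z \<in> carrier_vec n" for z
    using that w by (auto simp: vec_eq_iff add.assoc bit_add_self)
  have UNIV_bit: "(UNIV :: bit set) = {0, 1}"
    using bit.exhaust by auto
  have "mat_image (border n V w a) = (\<lambda>x. border n V w a *\<^sub>v x) ` carrier_vec (Suc n)"
    by (simp add: mat_image_def border_def)
  also have "\<dots> = (\<Union>c. (\<lambda>x. vec_snoc n (V *\<^sub>v x + c \<cdot>\<^sub>v w) (a * c)) ` carrier_vec n)"
    unfolding carrier_vec_Suc_eq_vec_snoc image_UN image_image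
    by (intro SUP_cong image_cong refl border_mult_vec_snoc V w)
  also have "\<dots> = (\<lambda>x. vec_snoc n (V *\<^sub>v x + 0 \<cdot>\<^sub>v w) (a * 0)) ` carrier_vec n
      \<union> (\<lambda>x. vec_snoc n (V *\<^sub>v x + 1 \<cdot>\<^sub>v w) (a * 1)) ` carrier_vec n"
    by (simp only: UNIV_bit) simp
  also have "\<dots> = ?f ` ?T \<union> ?g ` ?T"
    using V w T_carrier by (simp add: mat_image_def image_image zero_smult_vec cong: image_cong)
  finally have image: "mat_image (border n V w a) = ?f ` ?T \<union> ?g ` ?T" .
  have inj_f: "inj_on ?f ?T"
    using T_carrier by (auto simp: inj_on_def vec_snoc_eq_iff)
  show ?thesis
  proof (cases "w \<in> ?T")
    case True
    have "?g ` ?T = ?f ` ?T"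
    proof (intro equalityI subsetI)
      fix u assume "u \<in> ?g ` ?T"
      then show "u \<in> ?f ` ?T"
        using T_add True corner by auto
    next
      fix u assume "u \<in> ?f ` ?T"
      then obtain z where z: "z \<in> ?T" "u = ?f z"
        by auto
      then have "u = ?g (z + w)"
        using cancel[OF T_carrier] True corner by simp
      then show "u \<in> ?g ` ?T"
        using T_add z True by blast
    qed
    then show ?thesis
      using image inj_f True by (simp add: card_image)
  next
    case False
    have inj_g: "inj_on ?g ?T"
    proof (rule inj_onI)
      fix z z' assume zz: "z \<in> ?T" "z' \<in> ?T" "?g z = ?g z'"
      then have "z + w = z' + w"
        using T_carrier w by (auto simp: vec_snoc_eq_iff)
      then have "z + w + w = z' + w + w"
        by simp
      then show "z = z'"
        using cancel T_carrier zz by simp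
    qed
    \<comment> \<open>A common element would express \<open>w\<close> as a sum of two elements of \<open>T\<close>.\<close>
    have "?f z \<noteq> ?g z'" if zz: "z \<in> ?T" "z' \<in> ?T" for z z'
    proof
      assume "?f z = ?g z'"
      then have "z = z' + w"
        using T_carrier w zz by (auto simp: vec_snoc_eq_iff)
      then have "z' + z = w"
        using T_carrier[OF zz(2)] w by (auto simp: vec_eq_iff add.assoc[symmetric] bit_add_self)
      then show False
        using T_add zz False by blast
    qed
    then have "?f ` ?T \<inter> ?g ` ?T = {}"
      by blast
    then show ?thesis
      using image inj_f inj_g False T_finite by (simp add: card_Un_disjoint card_image)
  qed
qed

section \<open>The recursive structure of the two families\<close>

text \<open>
  The two families without the rank condition: removing the border may change the rank, so the
  induction on the size has to treat all ranks together.
\<close>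

definition square_zero :: "nat \<Rightarrow> bit mat set" where
  "square_zero n = {X \<in> carrier_mat n n. upper_triangular X \<and> X * X = 0\<^sub>m n n}"

definition self_orthogonal :: "nat \<Rightarrow> bit mat set" where
  "self_orthogonal n =
     {U \<in> carrier_mat n n. upper_triangular U \<and> transpose_mat U * U = 0\<^sub>m n n}"

lemma bij_betw_border_square_zero:
  "bij_betw (\<lambda>(Y, v). border n Y v 0) (SIGMA Y:square_zero n. mat_kernel Y) (square_zero (Suc n))"
proof (rule bij_betw_imageI)
  show "inj_on (\<lambda>(Y, v). border n Y v 0) (SIGMA Y:square_zero n. mat_kernel Y)"
    by (auto simp: inj_on_def square_zero_def mat_kernel border_eq_iff)
  have "X \<in> (\<lambda>(Y, v). border n Y v 0) ` (SIGMA Y:square_zero n. mat_kernel Y)"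
    if X: "X \<in> square_zero (Suc n)" for X
  proof -
    define Y v a where "Y = leading_block n X" and "v = vec n (\<lambda>i. X $$ (i, n))" and "a = X $$ (n, n)"
    have Yv: "Y \<in> carrier_mat n n" "v \<in> carrier_vec n"
      by (auto simp: Y_def v_def leading_block_def)
    have X_eq: "X = border n Y v a"
      using X border_leading_block by (simp add: square_zero_def Y_def v_def a_def)
    have "Y \<in> square_zero n" "v \<in> mat_kernel Y" "a = 0"
      using X Yv unfolding X_eq square_zero_def
      by (auto simp: border_square_zero_iff upper_triangular_border)
    then show ?thesis
      using X_eq by force
  qed
  moreover have "border n Y v 0 \<in> square_zero (Suc n)" if "Y \<in> square_zero n" "v \<in> mat_kernel Y" for Y v
    using that by (auto simp: square_zero_def border_square_zero_iff upper_triangular_border mat_kernelD)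
  ultimately show "(\<lambda>(Y, v). border n Y v 0) ` (SIGMA Y:square_zero n. mat_kernel Y) = square_zero (Suc n)"
    by auto
qed

lemma bij_betw_border_self_orthogonal:
  "bij_betw (\<lambda>(V, w). border n V w (w \<bullet> w))
     (SIGMA V:self_orthogonal n. mat_kernel (transpose_mat V)) (self_orthogonal (Suc n))"
proof (rule bij_betw_imageI)
  let ?S = "SIGMA V:self_orthogonal n. mat_kernel (transpose_mat V)"
  have carrier: "w \<in> carrier_vec n" if "V \<in> self_orthogonal n" "w \<in> mat_kernel (transpose_mat V)" for V w
    using that by (auto simp: self_orthogonal_def mat_kernel_def)
  then show "inj_on (\<lambda>(V, w). border n V w (w \<bullet> w)) ?S"
    by (auto simp: inj_on_def self_orthogonal_def border_eq_iff)
  have "U \<in> (\<lambda>(V, w). border n V w (w \<bullet> w)) ` ?S"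
    if U: "U \<in> self_orthogonal (Suc n)" for U
  proof -
    define V w a where "V = leading_block n U" and "w = vec n (\<lambda>i. U $$ (i, n))" and "a = U $$ (n, n)"
    have Vw: "V \<in> carrier_mat n n" "w \<in> carrier_vec n"
      by (auto simp: V_def w_def leading_block_def)
    have U_eq: "U = border n V w a"
      using U border_leading_block by (simp add: self_orthogonal_def V_def w_def a_def)
    have "V \<in> self_orthogonal n" "w \<in> mat_kernel (transpose_mat V)" "a = w \<bullet> w"
      using U Vw unfolding U_eq self_orthogonal_def
      by (auto simp: border_self_orthogonal_iff upper_triangular_border)
    then show ?thesis
      using U_eq by force
  qed
  moreover have "border n V w (w \<bullet> w) \<in> self_orthogonal (Suc n)"
    if "V \<in> self_orthogonal n" "w \<in> mat_kernel (transpose_mat V)" for V w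
    using that carrier[OF that]
    by (auto simp: self_orthogonal_def border_self_orthogonal_iff upper_triangular_border)
  ultimately show "(\<lambda>(V, w). border n V w (w \<bullet> w)) ` ?S = self_orthogonal (Suc n)"
    by auto
qed

lemma bij_betw_Sigma_fibres:
  assumes f: "bij_betw f A B" and g: "\<And>x. x \<in> A \<Longrightarrow> bij_betw (g x) (C x) (D (f x))"
  shows "bij_betw (\<lambda>(x, y). (f x, g x y)) (Sigma A C) (Sigma B D)"
proof (rule bij_betw_imageI)
  show "inj_on (\<lambda>(x, y). (f x, g x y)) (Sigma A C)"
    using f g by (auto simp: inj_on_def bij_betw_def)
  have "(\<lambda>(x, y). (f x, g x y)) ` Sigma A C = Sigma (f ` A) D"
    using bij_betw_imp_surj_on[OF g] by (fastforce simp: image_iff)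
  then show "(\<lambda>(x, y). (f x, g x y)) ` Sigma A C = Sigma B D"
    using bij_betw_imp_surj_on[OF f] by simp
qed

text \<open>
  For \<open>w = V x\<close>, \<open>w \<bullet> w = (V\<^sup>T V x) \<bullet> x\<close>. So the corner \<open>w \<bullet> w\<close> vanishes whenever the added
  column is in the image, as \<open>card_image_border\<close> requires.
\<close>

lemma self_orthogonal_image:
  fixes V :: "'a :: comm_ring_1 mat"
  assumes V: "V \<in> carrier_mat n n" "transpose_mat V * V = 0\<^sub>m n n" and w: "w \<in> mat_image V"
  shows "w \<bullet> w = 0"
proof -
  obtain x where x: "x \<in> carrier_vec n" "w = V *\<^sub>v x"
    using V w by (auto simp: mat_image_def)
  have "w \<in> mat_kernel (transpose_mat V)"
    using mat_image_subset_mat_kernel[of V n n "transpose_mat V"] V w by auto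
  then have "(transpose_mat V *\<^sub>v w) \<bullet> x = 0"
    using V(1) x by (simp add: mat_kernel_def)
  then show ?thesis
    using transpose_vec_mult_scalar[OF V(1) x(1), of w] V(1) x by simp
qed

text \<open>
  Both claims are proved in one induction, because the matching of columns in the next
  step is bijective only if the images of \<open>Y\<close> and \<open>Phi n Y\<close> have the same size.
\<close>

lemma Phi_bij_and_card_image:
  "bij_betw (Phi n) (square_zero n) (self_orthogonal n)
    \<and> (\<forall>X\<in>square_zero n. card (mat_image (Phi n X)) = card (mat_image X))"
proof (induction n)
  case 0
  have "square_zero 0 = self_orthogonal 0"
    by (auto simp: square_zero_def self_orthogonal_def mat_eq_iff)
  then show ?case
    by (auto simp: bij_betw_def inj_on_def)
next
  case (Suc n)
  let ?S = "SIGMA Y:square_zero n. mat_kernel Y"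
  let ?S' = "SIGMA V:self_orthogonal n. mat_kernel (transpose_mat V)"
  let ?B = "\<lambda>(Y, v). border n Y v 0" and ?B' = "\<lambda>(V, w). border n V w (w \<bullet> w)"
  \<comment> \<open>In the coordinates (leading block, last column), \<open>Phi\<close> is this map.\<close>
  let ?M = "\<lambda>(Y, v). (Phi n Y, match_col n Y (Phi n Y) v)"
  have bij: "bij_betw (Phi n) (square_zero n) (self_orthogonal n)"
    and card_eq: "\<And>Y. Y \<in> square_zero n \<Longrightarrow> card (mat_image (Phi n Y)) = card (mat_image Y)"
    using Suc by auto
  have Y_mat: "Y \<in> carrier_mat n n" "mat_image Y \<subseteq> mat_kernel Y" if "Y \<in> square_zero n" for Y
    using that mat_image_subset_mat_kernel[of Y n n Y n] by (auto simp: square_zero_def)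
  have V: "Phi n Y \<in> self_orthogonal n" if "Y \<in> square_zero n" for Y
    using bij that bij_betwE by blast
  have V_mat: "Phi n Y \<in> carrier_mat n n" "transpose_mat (Phi n Y) * Phi n Y = 0\<^sub>m n n"
    if "Y \<in> square_zero n" for Y
    using V[OF that] by (auto simp: self_orthogonal_def)
  have image_V: "mat_image (Phi n Y) \<subseteq> mat_kernel (transpose_mat (Phi n Y))" if "Y \<in> square_zero n" for Y
    using V_mat[OF that] by (intro mat_image_subset_mat_kernel) simp_all
  note match_bij = bij_betw_match_col[OF Y_mat V_mat(1) image_V card_eq[symmetric]]
  note match_image = match_col_in_image[OF Y_mat V_mat(1) image_V card_eq[symmetric]]
  have "bij_betw ?M ?S ?S'"
    using bij match_bij by (rule bij_betw_Sigma_fibres) simp_all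
  then have "bij_betw (?B' \<circ> ?M) ?S (self_orthogonal (Suc n))"
    using bij_betw_border_self_orthogonal by (rule bij_betw_trans)
  moreover have Phi_border: "Phi (Suc n) (?B p) = ?B' (?M p)" if "p \<in> ?S" for p
    using that Y_mat(1) mat_kernelD(1)[OF Y_mat(1)] by (auto simp: Let_def)
  ultimately have "bij_betw (Phi (Suc n) \<circ> ?B) ?S (self_orthogonal (Suc n))"
    by (subst bij_betw_cong[where g = "?B' \<circ> ?M"]) auto
  then have "bij_betw (Phi (Suc n)) (square_zero (Suc n)) (self_orthogonal (Suc n))"
    using bij_betw_comp_iff[OF bij_betw_border_square_zero] by blast
  moreover have "card (mat_image (Phi (Suc n) X)) = card (mat_image X)"
    if X: "X \<in> square_zero (Suc n)" for X
  proof -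
    have "X \<in> ?B ` ?S"
      using X bij_betw_imp_surj_on[OF bij_betw_border_square_zero[of n]] by simp
    then obtain Y v where Yv: "Y \<in> square_zero n" "v \<in> mat_kernel Y" "X = border n Y v 0"
      by auto
    let ?V = "Phi n Y"
    define w where "w = match_col n Y ?V v"
    have v: "v \<in> carrier_vec n"
      using Yv Y_mat by (auto simp: mat_kernel_def)
    have "w \<in> mat_kernel (transpose_mat ?V)"
      using match_bij[OF Yv(1,1,1,1,1)] Yv(2) bij_betwE unfolding w_def by blast
    then have w: "w \<in> carrier_vec n"
      using V_mat[OF Yv(1)] by (simp add: mat_kernel_def)
    have "Phi (Suc n) X = border n ?V w (w \<bullet> w)"
      using Phi_border[of "(Y, v)"] Yv by (simp add: w_def)
    then have "card (mat_image (Phi (Suc n) X))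
        = (if w \<in> mat_image ?V then 1 else 2) * card (mat_image ?V)"
      using card_image_border[OF V_mat(1)[OF Yv(1)] w] self_orthogonal_image[OF V_mat[OF Yv(1)]] by simp
    also have "\<dots> = (if v \<in> mat_image Y then 1 else 2) * card (mat_image Y)"
      using match_image[OF Yv(1,1,1,1,1,2)] card_eq[OF Yv(1)] by (simp add: w_def)
    also have "\<dots> = card (mat_image X)"
      using card_image_border[OF Y_mat(1)[OF Yv(1)] v, of 0] Yv(3) by simp
    finally show ?thesis .
  qed
  ultimately show ?case by blast
qed

lemma rank_eq_iff_card_image_eq:
  fixes A B :: "bit mat"
  assumes "A \<in> carrier_mat n n" "B \<in> carrier_mat n n"
  shows "vec_space.rank n A = vec_space.rank n B \<longleftrightarrow> card (mat_image A) = card (mat_image B)"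
  using assms by (simp add: vec_space.card_mat_image card_bit_vecs)

theorem theorem5p3:
  fixes n r :: nat
  assumes "r \<le> n"
  shows "bij_betw (Phi n) (square_zero_mats n r) (self_orthogonal_mats n r)"
proof -
  have bij: "bij_betw (Phi n) (square_zero n) (self_orthogonal n)"
    and card_eq: "\<And>X. X \<in> square_zero n \<Longrightarrow> card (mat_image (Phi n X)) = card (mat_image X)"
    using Phi_bij_and_card_image by auto
  have rank: "vec_space.rank n (Phi n X) = vec_space.rank n X" if "X \<in> square_zero n" for X
  proof -
    have "X \<in> carrier_mat n n" "Phi n X \<in> carrier_mat n n"
      using that bij_betwE[OF bij] by (auto simp: square_zero_def self_orthogonal_def)
    then show ?thesis
      using card_eq[OF that] by (simp add: rank_eq_iff_card_image_eq)
  qed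
  have "square_zero_mats n r = {X \<in> square_zero n. vec_space.rank n X = r}"
    by (auto simp: square_zero_mats_def square_zero_def)
  moreover have "self_orthogonal_mats n r = {U \<in> self_orthogonal n. vec_space.rank n U = r}"
    by (auto simp: self_orthogonal_mats_def self_orthogonal_def)
  moreover have "Phi n ` {X \<in> square_zero n. vec_space.rank n X = r}
      = {U \<in> self_orthogonal n. vec_space.rank n U = r}"
    unfolding bij_betw_imp_surj_on[OF bij, symmetric] using rank by auto
  ultimately show ?thesis
    using bij_betw_subset[OF bij, of "{X \<in> square_zero n. vec_space.rank n X = r}"] by auto
qed

end
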